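(* Let $\pi$ be a set of primes, and let $(B,+,\circ)$ be a finite soluble skew brace which is left nilpotent. Then the Hall $\pi$-sub-skew braces of $B$ coincide with the Hall $\pi$-subgroups of $(B,\circ)$; that is, a subset of $B$ is a Hall $\pi$-sub-skew brace of $B$ if and only if it is a Hall $\pi$-subgroup of $(B,\circ)$.
   Context: A skew (left) brace is a triple $(B,+,\circ)$ where $(B,+)$ and $(B,\circ)$ are (not necessarily abelian) groups with $a\circ(b+c)=a\circ b-a+a\circ c$ for all $a,b,c\in B$. The map $\lambda:(B,\circ)\to\operatorname{Aut}(B,+)$, $a\mapsto\lambda_a$, with $\lambda_a(b)=-a+a\circ b$, is a group homomorphism. Put $a\ast b=\lambda_a(b)-b=-a+a\circ b-b$, and for subsets $X,Y$ of $B$ let $X\ast Y$ be the subgroup of $(B,+)$ generated by all $x\ast y$ with $x\in X$, $y\in Y$. A sub-skew brace of $B$ is a subset that is a subgroup of both $(B,+)$ and $(B,\circ)$. An ideal of $B$ is a subset $I$ that is a normal subgroup of $(B,+)$, a normal subgroup of $(B,\circ)$, and satisfies $\lambda_a(I)\subseteq I$ for all $a\in B$; then $B/I$ is a skew brace with the induced operations. A skew brace is trivial of abelian type if its two operations coincide and its additive group is abelian. $B$ is soluble if there is a finite chain $\{0\}=I_0\leq I_1\leq\ldots\leq I_n=B$ of ideals of $B$ such that each $I_{j+1}/I_j$ is a trivial skew brace of abelian type. $B$ is left nilpotent if $B\ast(\ldots\ast(B\ast(B\ast B))\ldots)=\{0\}$ for some finite number of iterations, i.e. if $L_n=\{0\}$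 for some $n$, where $L_1=B$ and $L_{k+1}=B\ast L_k$. For a set of primes $\pi$, a $\pi$-number is a positive integer all of whose prime divisors lie in $\pi$. A Hall $\pi$-sub-skew brace of a finite skew brace $B$ is a sub-skew brace whose order is the largest $\pi$-number dividing $|B|$. *)

theory Defs
  imports
    "HOL-Algebra.QuotRing"
    "HOL-Algebra.Generated_Groups"
    "HOL-Computational_Algebra.Primes"
begin

section \<open>Skew braces\<close>

text \<open>
  A skew brace is carried by a \<^typ>\<open>'a ring\<close> record, of which only the signature is used: \<open>\<oplus>\<close> is the
  (not necessarily commutative) addition, \<open>\<otimes>\<close> is the circle operation. Thus the additive group is
  \<open>add_monoid B\<close>, and the circle group is \<open>B\<close> itself, read as a monoid record.
  No compatibility of \<open>\<zero>\<close> and \<open>\<one>\<close> is required; they coincide by lemma \<open>one_eq_zero\<close> below.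
\<close>

locale skew_brace = additive: group "add_monoid B" + multiplicative: group B
  for B (structure) +
  assumes skew_distrib:
    "\<lbrakk>a \<in> carrier B; b \<in> carrier B; c \<in> carrier B\<rbrakk>
      \<Longrightarrow> a \<otimes> (b \<oplus> c) = ((a \<otimes> b) \<ominus> a) \<oplus> (a \<otimes> c)"

definition lam :: "('a, 'm) ring_scheme \<Rightarrow> 'a \<Rightarrow> 'a \<Rightarrow> 'a"
  where "lam B a b = (\<ominus>\<^bsub>B\<^esub> a) \<oplus>\<^bsub>B\<^esub> (a \<otimes>\<^bsub>B\<^esub> b)"

definition star :: "('a, 'm) ring_scheme \<Rightarrow> 'a \<Rightarrow> 'a \<Rightarrow> 'a"
  where "star B a b = lam B a b \<ominus>\<^bsub>B\<^esub> b"

definition star_set :: "('a, 'm) ring_scheme \<Rightarrow> 'a set \<Rightarrow> 'a set \<Rightarrow> 'a set"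
  where "star_set B X Y = generate (add_monoid B) {star B x y |x y. x \<in> X \<and> y \<in> Y}"

definition sub_skew_brace :: "'a set \<Rightarrow> ('a, 'm) ring_scheme \<Rightarrow> bool"
  where "sub_skew_brace H B \<longleftrightarrow> subgroup H (add_monoid B) \<and> subgroup H B"

definition skew_brace_ideal :: "'a set \<Rightarrow> ('a, 'm) ring_scheme \<Rightarrow> bool"
  where "skew_brace_ideal I B \<longleftrightarrow>
    I \<lhd> add_monoid B \<and> I \<lhd> B \<and> (\<forall>a\<in>carrier B. lam B a ` I \<subseteq> I)"

locale trivial_skew_brace_of_abelian_type = skew_brace +
  assumes operations_coincide: "\<lbrakk>a \<in> carrier B; b \<in> carrier B\<rbrakk> \<Longrightarrow> a \<otimes> b = a \<oplus> b"
    and additive_abelian: "comm_group (add_monoid B)"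

text \<open>
  The quotient by an ideal is formed with the library's \<open>Quot\<close>: its elements are the additive cosets
  of \<open>I\<close>, added by \<open>set_add\<close> and multiplied by \<open>rcoset_mult\<close>. Neither needs the ring axioms to be
  the induced operations; see lemmas \<open>quotient_add\<close>, \<open>quotient_mult\<close> and \<open>quotient_skew_brace\<close> below.
  The factor \<open>I (Suc j) / I j\<close> is the quotient of the sub-skew brace \<open>I (Suc j)\<close>.
\<close>

definition soluble_skew_brace :: "('a, 'm) ring_scheme \<Rightarrow> bool"
  where "soluble_skew_brace B \<longleftrightarrow>
    (\<exists>(n :: nat) (I :: nat \<Rightarrow> 'a set).
      I 0 = {\<zero>\<^bsub>B\<^esub>} \<and> I n = carrier B \<and>
      (\<forall>j\<le>n. skew_brace_ideal (I j) B) \<and>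
      (\<forall>j<n. I j \<subseteq> I (Suc j) \<and>
        trivial_skew_brace_of_abelian_type (B\<lparr>carrier := I (Suc j)\<rparr> Quot I j)))"

text \<open>The series is indexed from 0, so that \<open>left_series B k\<close> is \<open>L\<^sub>k\<^sub>+\<^sub>1\<close> where \<open>L\<^sub>1 = B\<close>.\<close>

primrec left_series :: "('a, 'm) ring_scheme \<Rightarrow> nat \<Rightarrow> 'a set"
  where
    "left_series B 0 = carrier B"
  | "left_series B (Suc k) = star_set B (carrier B) (left_series B k)"

definition left_nilpotent :: "('a, 'm) ring_scheme \<Rightarrow> bool"
  where "left_nilpotent B \<longleftrightarrow> (\<exists>k. left_series B k = {\<zero>\<^bsub>B\<^esub>})"


section \<open>Hall subobjects\<close>

text \<open>
  The qualified name keeps these definitions apart from the constant \<open>prime\<close> of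
  \<open>HOL-Algebra.Divisibility\<close>.
\<close>

definition pi_number :: "nat set \<Rightarrow> nat \<Rightarrow> bool"
  where "pi_number \<pi> m \<longleftrightarrow> m > 0 \<and> (\<forall>p. Factorial_Ring.prime p \<and> p dvd m \<longrightarrow> p \<in> \<pi>)"

definition pi_part :: "nat set \<Rightarrow> nat \<Rightarrow> nat"
  where "pi_part \<pi> n = (GREATEST m. pi_number \<pi> m \<and> m dvd n)"

definition hall_subgroup :: "nat set \<Rightarrow> 'a set \<Rightarrow> ('a, 'm) monoid_scheme \<Rightarrow> bool"
  where "hall_subgroup \<pi> H G \<longleftrightarrow> subgroup H G \<and> card H = pi_part \<pi> (order G)"

definition hall_sub_skew_brace :: "nat set \<Rightarrow> 'a set \<Rightarrow> ('a, 'm) ring_scheme \<Rightarrow> bool"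
  where "hall_sub_skew_brace \<pi> H B \<longleftrightarrow> sub_skew_brace H B \<and> card H = pi_part \<pi> (order B)"


section \<open>Basic facts\<close>

lemma pi_part_greatest:
  assumes "n > 0"
  shows "pi_number \<pi> (pi_part \<pi> n)" "pi_part \<pi> n dvd n"
    and "\<And>m. pi_number \<pi> m \<Longrightarrow> m dvd n \<Longrightarrow> m \<le> pi_part \<pi> n"
proof -
  have one: "pi_number \<pi> 1 \<and> 1 dvd n" by (auto simp: pi_number_def)
  have bound: "\<And>m. pi_number \<pi> m \<and> m dvd n \<Longrightarrow> m \<le> n" using assms by (auto intro: dvd_imp_le)
  show "pi_number \<pi> (pi_part \<pi> n)" "pi_part \<pi> n dvd n"
    using GreatestI_nat[of "\<lambda>m. pi_number \<pi> m \<and> m dvd n", OF one bound]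
    by (auto simp: pi_part_def)
  show "m \<le> pi_part \<pi> n" if "pi_number \<pi> m" "m dvd n" for m
    using Greatest_le_nat[of "\<lambda>m. pi_number \<pi> m \<and> m dvd n" m n] that bound
    by (auto simp: pi_part_def)
qed

context skew_brace
begin

lemma add_simps [simp]:
  "a \<in> carrier B \<Longrightarrow> b \<in> carrier B \<Longrightarrow> a \<oplus> b \<in> carrier B"
  "\<zero> \<in> carrier B"
  "a \<in> carrier B \<Longrightarrow> \<ominus> a \<in> carrier B"
  "a \<in> carrier B \<Longrightarrow> a \<oplus> \<zero> = a"
  "a \<in> carrier B \<Longrightarrow> \<zero> \<oplus> a = a"
  "a \<in> carrier B \<Longrightarrow> \<ominus> a \<oplus> a = \<zero>"
  "a \<in> carrier B \<Longrightarrow> a \<oplus> \<ominus> a = \<zero>"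
  using additive.m_closed additive.one_closed additive.inv_closed additive.r_one
    additive.l_one additive.l_inv additive.r_inv
  by (auto simp: a_inv_def)

lemma add_assoc:
  "a \<in> carrier B \<Longrightarrow> b \<in> carrier B \<Longrightarrow> c \<in> carrier B \<Longrightarrow> (a \<oplus> b) \<oplus> c = a \<oplus> (b \<oplus> c)"
  using additive.m_assoc by simp

lemma add_cancel [simp]:
  "a \<in> carrier B \<Longrightarrow> b \<in> carrier B \<Longrightarrow> \<ominus> a \<oplus> (a \<oplus> b) = b"
  "a \<in> carrier B \<Longrightarrow> b \<in> carrier B \<Longrightarrow> a \<oplus> (\<ominus> a \<oplus> b) = b"
  by (simp_all flip: add_assoc)

lemma one_eq_zero: "\<one> = \<zero>"
proof -
  have "\<zero> = \<ominus> \<one>"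
    using skew_distrib[of \<one> \<zero> \<zero>] by (simp add: a_minus_def)
  then show ?thesis
    by (metis add_simps(4,7) multiplicative.one_closed)
qed

lemma mult_eq_lam:
  "a \<in> carrier B \<Longrightarrow> b \<in> carrier B \<Longrightarrow> a \<otimes> b = a \<oplus> lam B a b"
  by (simp add: lam_def)

lemma lam_closed [simp]: "a \<in> carrier B \<Longrightarrow> b \<in> carrier B \<Longrightarrow> lam B a b \<in> carrier B"
  by (simp add: lam_def)

lemma lam_add:
  "a \<in> carrier B \<Longrightarrow> b \<in> carrier B \<Longrightarrow> c \<in> carrier B
    \<Longrightarrow> lam B a (b \<oplus> c) = lam B a b \<oplus> lam B a c"
  by (simp add: lam_def skew_distrib a_minus_def add_assoc)

end

locale skew_brace_with_ideal = skew_brace +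
  fixes I
  assumes ideal: "skew_brace_ideal I B"
begin

sublocale additive: normal I "add_monoid B"
  using ideal by (simp add: skew_brace_ideal_def)

sublocale multiplicative: normal I B
  using ideal by (simp add: skew_brace_ideal_def)

lemma lam_ideal: "a \<in> carrier B \<Longrightarrow> x \<in> I \<Longrightarrow> lam B a x \<in> I"
  using ideal by (auto simp: skew_brace_ideal_def)

lemma add_coset_eq_mult_coset:
  assumes a: "a \<in> carrier B"
  shows "I +> a = I #> a"
proof -
  have "I #> a = a <# I" using multiplicative.coset_eq a by simp
  also have "a <# I = a <#\<^bsub>add_monoid B\<^esub> I"
  proof (intro equalityI subsetI)
    fix z assume "z \<in> a <# I"
    then obtain x where "x \<in> I" "z = a \<otimes> x" by (auto simp: l_coset_def)
    then show "z \<in> a <#\<^bsub>add_monoid B\<^esub> I"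
      using a lam_ideal mult_eq_lam multiplicative.subset by (auto simp: l_coset_def)
  next
    fix z assume "z \<in> a <#\<^bsub>add_monoid B\<^esub> I"
    then obtain x where x: "x \<in> I" "z = a \<oplus> x" by (auto simp: l_coset_def)
    have xc: "x \<in> carrier B" using x multiplicative.subset by blast
    define y where "y = lam B (inv a) x"
    have y: "y \<in> I" "y \<in> carrier B"
      using lam_ideal x a multiplicative.subset by (auto simp: y_def)
    have "a \<otimes> (inv a \<oplus> y) = a \<otimes> (inv a \<otimes> x)"
      using a xc by (simp add: y_def flip: mult_eq_lam)
    also have "\<dots> = x" using a xc by (simp flip: multiplicative.m_assoc)
    finally have "((a \<otimes> inv a) \<ominus> a) \<oplus> (a \<otimes> y) = x" using a y by (simp add: skew_distrib)
    then have "\<ominus> a \<oplus> (a \<otimes> y) = x" using a by (simp add: a_minus_def one_eq_zero)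
    then have "a \<oplus> x = a \<otimes> y" using a y by auto
    then show "z \<in> a <# I" using x y by (auto simp: l_coset_def)
  qed
  also have "\<dots> = I +> a" using additive.coset_eq a by (simp add: a_r_coset_def)
  finally show ?thesis ..
qed

lemma quotient_add:
  "a \<in> carrier B \<Longrightarrow> b \<in> carrier B \<Longrightarrow> (I +> a) \<oplus>\<^bsub>B Quot I\<^esub> (I +> b) = I +> (a \<oplus> b)"
  using additive.rcos_sum[of a b] by (simp add: FactRing_def set_add_def a_r_coset_def)

lemma quotient_mult:
  assumes "a \<in> carrier B" "b \<in> carrier B"
  shows "(I +> a) \<otimes>\<^bsub>B Quot I\<^esub> (I +> b) = I +> (a \<otimes> b)"
proof -
  have eq: "I +> (x \<otimes> y) = I +> (a \<otimes> b)" if "x \<in> I +> a" "y \<in> I +> b" for x y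
  proof -
    have xy: "x \<in> I #> a" "y \<in> I #> b" using that assms by (simp_all add: add_coset_eq_mult_coset)
    have c: "x \<in> carrier B" "y \<in> carrier B"
      using subsetD[OF multiplicative.r_coset_subset_G[OF multiplicative.subset assms(1)] xy(1)]
        subsetD[OF multiplicative.r_coset_subset_G[OF multiplicative.subset assms(2)] xy(2)] .
    have "I #> (x \<otimes> y) = (I #> x) <#> (I #> y)"
      using c by (simp add: multiplicative.rcos_sum)
    also have "\<dots> = (I #> a) <#> (I #> b)"
      using multiplicative.repr_independence[OF xy(1) assms(1) multiplicative.subgroup_axioms]
        multiplicative.repr_independence[OF xy(2) assms(2) multiplicative.subgroup_axioms] by simp
    also have "\<dots> = I #> (a \<otimes> b)" using assms by (simp add: multiplicative.rcos_sum)
    finally show ?thesis using c assms by (simp add: add_coset_eq_mult_coset)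
  qed
  have mem: "a \<in> I +> a" "b \<in> I +> b"
    using assms multiplicative.rcos_self[OF _ multiplicative.subgroup_axioms]
    by (simp_all add: add_coset_eq_mult_coset)
  have "(\<Union>x\<in>I +> a. \<Union>y\<in>I +> b. I +> (x \<otimes> y)) = (\<Union>x\<in>I +> a. \<Union>y\<in>I +> b. I +> (a \<otimes> b))"
    by (intro SUP_cong refl eq)
  also have "\<dots> = I +> (a \<otimes> b)" using mem by blast
  finally show ?thesis by (simp add: FactRing_def rcoset_mult_def)
qed

lemma quotient_carrier: "carrier (B Quot I) = (\<lambda>a. I +> a) ` carrier B"
  by (auto simp: FactRing_def A_RCOSETS_def RCOSETS_def a_r_coset_def)

theorem quotient_skew_brace: "skew_brace (B Quot I)"
proof -
  let ?Q = "B Quot I"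
  have zero: "\<zero>\<^bsub>?Q\<^esub> = I +> \<zero>" "\<one>\<^bsub>?Q\<^esub> = I +> \<one>"
    using additive.coset_mult_one[OF additive.subset]
    by (simp_all add: FactRing_def a_r_coset_def)
  have add_group: "group (add_monoid ?Q)"
  proof (rule groupI)
    fix x assume "x \<in> carrier (add_monoid ?Q)"
    then obtain a where a: "a \<in> carrier B" "x = I +> a" by (auto simp: quotient_carrier)
    then show "\<exists>y\<in>carrier (add_monoid ?Q). y \<otimes>\<^bsub>add_monoid ?Q\<^esub> x = \<one>\<^bsub>add_monoid ?Q\<^esub>"
      by (intro bexI[of _ "I +> \<ominus> a"]) (auto simp: quotient_carrier quotient_add zero)
  qed (auto simp: quotient_carrier quotient_add zero add_assoc)
  have mult_group: "group ?Q"
  proof (rule groupI)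
    fix x assume "x \<in> carrier ?Q"
    then obtain a where a: "a \<in> carrier B" "x = I +> a" by (auto simp: quotient_carrier)
    then show "\<exists>y\<in>carrier ?Q. y \<otimes>\<^bsub>?Q\<^esub> x = \<one>\<^bsub>?Q\<^esub>"
      by (intro bexI[of _ "I +> inv a"]) (auto simp: quotient_carrier quotient_mult zero)
  qed (auto simp: quotient_carrier quotient_mult zero multiplicative.m_assoc)
  have neg: "\<ominus>\<^bsub>?Q\<^esub> (I +> a) = I +> \<ominus> a" if "a \<in> carrier B" for a
    unfolding a_inv_def[of ?Q]
    using that by (intro group.inv_equality[OF add_group]) (auto simp: quotient_carrier quotient_add zero)
  show ?thesis
  proof (intro skew_brace.intro skew_brace_axioms.intro add_group mult_group)
    fix x y z assume "x \<in> carrier ?Q" "y \<in> carrier ?Q" "z \<in> carrier ?Q"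
    then show "x \<otimes>\<^bsub>?Q\<^esub> (y \<oplus>\<^bsub>?Q\<^esub> z) = ((x \<otimes>\<^bsub>?Q\<^esub> y) \<ominus>\<^bsub>?Q\<^esub> x) \<oplus>\<^bsub>?Q\<^esub> (x \<otimes>\<^bsub>?Q\<^esub> z)"
      by (auto simp: quotient_carrier quotient_mult quotient_add neg a_minus_def skew_distrib)
  qed
qed

end

end

theory Submission
  imports Defs "HOL-Algebra.Multiplicative_Group"
begin

text \<open>
  A Hall subgroup \<open>H\<close> of \<open>(B, \<circ>)\<close> enters the argument only through the coprimality of its order and
  its index, and the claim is that \<open>H\<close> is then a subgroup of \<open>(B, +)\<close>. Let
  \<open>{0} = I\<^sub>0 \<le> \<dots> \<le> I\<^sub>n = B\<close> be the ideal series given by solubility. By descent along \<open>j\<close>, each product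
  \<open>I\<^sub>j \<circ> H\<close> is an additive subgroup: this is clear for \<open>j = n\<close>, and for \<open>j = 0\<close> it is the claim. For
  the step one works in \<open>B / I\<^sub>j\<close>, where \<open>A = I\<^sub>j\<^sub>+\<^sub>1 / I\<^sub>j\<close> is an ideal on which both operations agree and
  commute, and where the image of \<open>H\<close>, again called \<open>H\<close>, still has coprime order and index. Thus it
  remains to see: if \<open>A \<circ> H\<close> is an additive subgroup, then so is \<open>H\<close>.

  Let \<open>m = |H|\<close>. By coprimality \<open>A\<close> is the product of \<open>A \<inter> H\<close> and of the ideal \<open>P\<close> of all \<open>m\<close>-th powers
  of elements of \<open>A\<close>, on which \<open>x \<mapsto> x\<^sup>m\<close> is injective. Hence \<open>A \<circ> H = P \<circ> H\<close>, and \<open>A\<close> may be replaced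
  by \<open>P\<close> (lemma \<open>additive_subgroup_of_coprime_index\<close>). On \<open>P\<close> each \<open>\<lambda>\<^sub>h\<close> with \<open>h \<in> H\<close> is
  unipotent by left nilpotency, and its \<open>m\<close>-th power is the identity; as \<open>P\<close> has no \<open>m\<close>-torsion,
  \<open>\<lambda>\<^sub>h\<close> fixes \<open>P\<close> pointwise (lemma \<open>lam_fix_of_nilpotent\<close>).

  The core is an averaging argument as in the proof of the Schur-Zassenhaus theorem. The set \<open>H\<close> is a
  transversal of \<open>P\<close> in \<open>K = P \<circ> H\<close>, so each \<open>y \<in> K\<close> is uniquely \<open>y = \<delta>(y) + h\<close> with \<open>\<delta>(y) \<in> P\<close> and
  \<open>h \<in> H\<close>. Put \<open>D(c) = \<Sum>\<^sub>k \<delta>(c + k)\<close>, the sum running over \<open>k \<in> H\<close>. This measures how far the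
  transversals \<open>H\<close> and \<open>c + H\<close> are apart; it satisfies \<open>D(b + c) = (b + D(c) - b) + D(b)\<close>, so that its
  zeros form an additive subgroup, and \<open>D(x) = m x\<close> for \<open>x \<in> P\<close>, so that this subgroup meets \<open>P\<close>
  trivially. The link with \<open>\<circ>\<close> is that \<open>-h + H = \<lambda>\<^sub>h(H)\<close>, because \<open>h \<circ> H = H\<close>. Since \<open>\<lambda>\<close> is
  multiplicative and \<open>H\<close> acts trivially on \<open>P\<close>, the map \<open>h \<mapsto> D(-h)\<close> is a homomorphism from \<open>(H, \<circ>)\<close> to
  \<open>P\<close>. As \<open>m\<close> annihilates its values, it vanishes. So all of \<open>H\<close> consists of zeros of \<open>D\<close>; there are no
  others in \<open>K\<close>, and \<open>H\<close> is an additive subgroup.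
\<close>

section \<open>Index and powers in finite groups\<close>

lemma (in group_hom) card_image_times_card_kernel:
  assumes fin: "finite (carrier G)" and K: "subgroup K G"
  shows "card (h ` K) * card (K \<inter> kernel G H h) = card K"
proof -
  have Kc: "K \<subseteq> carrier G" using K by (rule subgroup.subset)
  have finK: "finite K" using Kc fin by (rule finite_subset)
  have fibre: "card {x \<in> K. h x = h k} = card (K \<inter> kernel G H h)" if k: "k \<in> K" for k
  proof -
    have kc: "k \<in> carrier G" using k Kc by blast
    have "bij_betw (\<lambda>x. x \<otimes> k) (K \<inter> kernel G H h) {x \<in> K. h x = h k}"
    proof (rule bij_betwI[where g = "\<lambda>x. x \<otimes> inv k"])
      show "(\<lambda>x. x \<otimes> k) \<in> K \<inter> kernel G H h \<rightarrow> {x \<in> K. h x = h k}"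
        using k kc Kc K by (auto simp: kernel_def subgroup.m_closed)
      show "(\<lambda>x. x \<otimes> inv k) \<in> {x \<in> K. h x = h k} \<rightarrow> K \<inter> kernel G H h"
        using k kc Kc K by (auto simp: kernel_def subgroup.m_closed subgroup.m_inv_closed subset_iff)
    qed (use kc Kc in \<open>auto simp: G.m_assoc subset_iff\<close>)
    then show ?thesis using bij_betw_same_card by metis
  qed
  have "card K = (\<Sum>y\<in>h ` K. card {x \<in> K. h x = y})"
    using sum.image_gen[OF finK, of "\<lambda>_. 1::nat" h] by simp
  also have "\<dots> = (\<Sum>y\<in>h ` K. card (K \<inter> kernel G H h))"
    by (rule sum.cong) (auto simp: fibre)
  finally show ?thesis by simp
qed

text \<open>
  The index of \<open>K\<close> splits into the index of its image and that of its trace on the kernel. The first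
  factor shows that coprimality of order and index passes to quotients; the second one bounds
  the index of \<open>K\<close> inside a normal subgroup.
\<close>

lemma (in group_hom) index_factorization:
  assumes fin: "finite (carrier G)" and surj: "h ` carrier G = carrier H"
    and K: "subgroup K G" and t: "order G = card K * t"
  obtains u s where "t = u * s" "order H = card (h ` K) * u"
    "card (kernel G H h) = card (K \<inter> kernel G H h) * s"
proof -
  let ?N = "kernel G H h"
  obtain u where u: "order H = card (h ` K) * u"
    using H.lagrange[OF subgroup_img_is_subgroup[OF K]] by (metis mult.commute)
  have sub: "subgroup (K \<inter> ?N) (G\<lparr>carrier := ?N\<rparr>)"
    by (rule subgroup.intro)
      (use K subgroup_kernel subgroups_Inter_pair in
        \<open>auto simp: subgroup.m_closed subgroup.one_closed subgroup.m_inv_closed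
          G.m_inv_consistent\<close>)
  have "group (G\<lparr>carrier := ?N\<rparr>)" using subgroup_kernel by (rule G.subgroup_imp_group)
  then obtain s where s: "card ?N = card (K \<inter> ?N) * s"
    using group.lagrange[OF _ sub] by (auto simp: order_def) (metis mult.commute)
  have c1: "order H * card ?N = order G"
    using card_image_times_card_kernel[OF fin G.subgroup_self] surj
    by (simp add: order_def kernel_def Int_def conj_ac)
  have c2: "card (h ` K) * card (K \<inter> ?N) = card K"
    using card_image_times_card_kernel[OF fin K] .
  have "card K * t = card K * (u * s)"
    using c1 u s t by (metis c2 mult.assoc mult.left_commute)
  moreover have "card K > 0"
    using K fin by (simp add: subgroup.finite_imp_card_positive)
  ultimately have "t = u * s" by simp
  then show ?thesis using u s that by blast
qed

text \<open>
  \<open>K \<inter> H\<close> is normal in the abelian group \<open>H\<close>, and its index there divides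
  the index of \<open>K\<close> in \<open>G\<close>.
\<close>

lemma (in normal) pow_index_mem:
  assumes fin: "finite (carrier G)" and K: "subgroup K G" and t: "order G = card K * t"
    and comm: "comm_group (G\<lparr>carrier := H\<rparr>)" and a: "a \<in> H"
  shows "a [^] t \<in> K"
proof -
  let ?S = "G\<lparr>carrier := H\<rparr>"
  interpret S: comm_group ?S by fact
  interpret q: group_hom G "G Mod H" "(#>) H"
    using r_coset_hom_Mod factorgroup_is_group by (simp add: group_hom_def group_hom_axioms_def is_group)
  have ker: "kernel G (G Mod H) ((#>) H) = H"
    using subset coset_join1[OF _ _ subgroup_axioms] coset_join2[OF _ subgroup_axioms]
    by (auto simp: kernel_def)
  obtain u s where us: "t = u * s" "card H = card (K \<inter> H) * s"
    using q.index_factorization[OF fin _ K t] unfolding ker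
    by (metis carrier_FactGroup)
  have sub: "subgroup (K \<inter> H) ?S"
    by (rule subgroup.intro)
      (use K subgroup_axioms in
        \<open>auto simp: subgroup.m_closed subgroup.one_closed subgroup.m_inv_closed m_inv_consistent\<close>)
  interpret N: normal "K \<inter> H" ?S using sub by (rule S.subgroup_imp_normal)
  have oQ: "order (?S Mod (K \<inter> H)) = s"
  proof -
    have "order (?S Mod (K \<inter> H)) * card (K \<inter> H) = card H"
      using S.lagrange[OF sub] by (simp add: FactGroup_def order_def)
    moreover have "card (K \<inter> H) > 0"
      using sub fin finite_subset[OF subset] by (simp add: subgroup.finite_imp_card_positive)
    ultimately show ?thesis using us by simp
  qed
  have "(K \<inter> H) #>\<^bsub>?S\<^esub> (a [^]\<^bsub>?S\<^esub> s) = ((K \<inter> H) #>\<^bsub>?S\<^esub> a) [^]\<^bsub>?S Mod (K \<inter> H)\<^esub> s"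
    using N.FactGroup_pow[of a s] a by simp
  also have "\<dots> = K \<inter> H"
    using group.pow_order_eq_1[OF N.factorgroup_is_group, of "(K \<inter> H) #>\<^bsub>?S\<^esub> a"] a oQ
    by (simp add: carrier_FactGroup)
  finally have "a [^]\<^bsub>?S\<^esub> s \<in> K \<inter> H"
    using S.rcos_self[OF _ sub, of "a [^]\<^bsub>?S\<^esub> s"] S.nat_pow_closed[of a s] a by simp
  then have "a [^] s \<in> K" by (simp add: nat_pow_consistent[symmetric])
  then have "(a [^] s) [^] u \<in> K"
    using K by (metis subgroup_int_pow_closed int_pow_int)
  then show ?thesis using a us(1) by (simp add: nat_pow_pow mult.commute)
qed

lemma (in comm_group) endo_finprod:
  assumes \<phi>: "\<phi> \<in> hom G G" and f: "f \<in> S \<rightarrow> carrier G"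
  shows "\<phi> (finprod G f S) = finprod G (\<lambda>i. \<phi> (f i)) S"
proof -
  interpret \<phi>: group_hom G G \<phi> using \<phi> by unfold_locales
  show ?thesis using f
    by (induction S rule: infinite_finite_induct) (auto simp: Pi_iff)
qed

lemma (in group_hom) hom_set_mult:
  assumes "U \<subseteq> carrier G" "V \<subseteq> carrier G"
  shows "h ` (U <#> V) = h ` U <#>\<^bsub>H\<^esub> h ` V"
  using assms by (force simp: set_mult_def)

section \<open>Unipotent action on an abelian layer\<close>

context skew_brace
begin

lemma neg_neg [simp]: "a \<in> carrier B \<Longrightarrow> \<ominus> (\<ominus> a) = a"
  using additive.inv_inv[of a] by (simp add: a_inv_def)

lemma add_left_cancel [simp]:
  "a \<in> carrier B \<Longrightarrow> b \<in> carrier B \<Longrightarrow> c \<in> carrier B \<Longrightarrow> a \<oplus> b = a \<oplus> c \<longleftrightarrow> b = c"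
  by (metis add_cancel(1))

lemma lam_mult:
  assumes "a \<in> carrier B" "b \<in> carrier B" "c \<in> carrier B"
  shows "lam B (a \<otimes> b) c = lam B a (lam B b c)"
proof -
  have "(a \<otimes> b) \<oplus> lam B (a \<otimes> b) c = a \<otimes> (b \<otimes> c)"
    using assms by (simp add: multiplicative.m_assoc flip: mult_eq_lam)
  also have "\<dots> = (a \<otimes> b) \<oplus> lam B a (lam B b c)"
    using assms by (simp add: mult_eq_lam lam_add add_assoc)
  finally show ?thesis using assms by simp
qed

lemma lam_one: "a \<in> carrier B \<Longrightarrow> lam B \<one> a = a"
  using additive.inv_one by (simp add: lam_def one_eq_zero a_inv_def multiplicative.l_one[unfolded one_eq_zero])

lemma lam_zero: "a \<in> carrier B \<Longrightarrow> lam B a \<zero> = \<zero>"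
  using multiplicative.r_one[of a] unfolding one_eq_zero by (simp add: lam_def)

lemma lam_eq_star_add: "a \<in> carrier B \<Longrightarrow> b \<in> carrier B \<Longrightarrow> lam B a b = star B a b \<oplus> b"
  by (simp add: star_def a_minus_def add_assoc)

lemma star_closed [simp]: "a \<in> carrier B \<Longrightarrow> b \<in> carrier B \<Longrightarrow> star B a b \<in> carrier B"
  by (simp add: star_def a_minus_def)

lemma star_zero: "a \<in> carrier B \<Longrightarrow> star B a \<zero> = \<zero>"
  by (simp add: star_def a_minus_def lam_zero)

lemma star_eq_zero_iff:
  "a \<in> carrier B \<Longrightarrow> b \<in> carrier B \<Longrightarrow> star B a b = \<zero> \<longleftrightarrow> lam B a b = b"
  using lam_eq_star_add[of a b] by (auto simp: star_def a_minus_def)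

text \<open>
  Left nilpotency makes each map \<open>star B a\<close> nilpotent, with a bound on the exponent that is uniform
  in \<open>a\<close>. Unlike the left series, this consequence is elementwise and so passes to quotients
  at once.
\<close>

lemma star_funpow_mem_left_series:
  assumes "a \<in> carrier B" "x \<in> carrier B"
  shows "(star B a ^^ k) x \<in> left_series B k"
  by (induction k) (use assms in \<open>auto simp: star_set_def intro!: generate.incl\<close>)

lemma pow_subgroup_card:
  assumes "subgroup H B" "h \<in> H"
  shows "h [^] card H = \<one>"
  using group.pow_order_eq_1[OF multiplicative.subgroup_imp_group[OF assms(1)], of h] assms(2)
  by (simp add: order_def multiplicative.nat_pow_consistent[symmetric])

end

text \<open>
  An ideal that is itself a trivial skew brace of abelian type, such as a factor of the series in
  the quotient by the preceding term. Its group is written with \<open>\<otimes>\<close>, so that the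
  library's powers and finite products apply to it.
\<close>

locale abelian_layer = skew_brace_with_ideal +
  assumes trivial: "x \<in> I \<Longrightarrow> y \<in> I \<Longrightarrow> x \<otimes> y = x \<oplus> y"
    and abelian: "x \<in> I \<Longrightarrow> y \<in> I \<Longrightarrow> x \<oplus> y = y \<oplus> x"
begin

lemma I_closed: "x \<in> I \<Longrightarrow> x \<in> carrier B"
  using multiplicative.subset by blast

lemma layer_group: "comm_group (B\<lparr>carrier := I\<rparr>)"
proof -
  interpret S: group "B\<lparr>carrier := I\<rparr>"
    using multiplicative.subgroup_axioms by (rule multiplicative.subgroup_imp_group)
  show ?thesis by (rule S.group_comm_groupI) (simp add: trivial abelian)
qed

lemma conj_mem: "b \<in> carrier B \<Longrightarrow> x \<in> I \<Longrightarrow> b \<oplus> x \<oplus> \<ominus> b \<in> I"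
  using additive.inv_op_closed2[of b x] by (simp add: a_inv_def)

lemma conj_hom:
  assumes b: "b \<in> carrier B"
  shows "(\<lambda>x. b \<oplus> x \<oplus> \<ominus> b) \<in> hom (B\<lparr>carrier := I\<rparr>) (B\<lparr>carrier := I\<rparr>)"
proof (rule homI)
  fix x y assume "x \<in> carrier (B\<lparr>carrier := I\<rparr>)" "y \<in> carrier (B\<lparr>carrier := I\<rparr>)"
  then show "b \<oplus> x \<otimes>\<^bsub>B\<lparr>carrier := I\<rparr>\<^esub> y \<oplus> \<ominus> b
      = (b \<oplus> x \<oplus> \<ominus> b) \<otimes>\<^bsub>B\<lparr>carrier := I\<rparr>\<^esub> (b \<oplus> y \<oplus> \<ominus> b)"
    using b trivial[OF conj_mem conj_mem, of b x b y] by (simp add: trivial I_closed add_assoc)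
qed (use b conj_mem in auto)

lemma lam_hom:
  assumes b: "b \<in> carrier B"
  shows "lam B b \<in> hom (B\<lparr>carrier := I\<rparr>) (B\<lparr>carrier := I\<rparr>)"
  by (rule homI) (use b in \<open>auto simp: trivial lam_ideal I_closed lam_add\<close>)

lemma star_mem: "a \<in> carrier B \<Longrightarrow> x \<in> I \<Longrightarrow> star B a x \<in> I"
  unfolding star_def a_minus_def
  using additive.m_closed additive.m_inv_closed lam_ideal by (simp add: a_inv_def)

text \<open>
  Write \<open>T = \<lambda>\<^sub>a\<close> and \<open>y = T x - x\<close>. If \<open>T y = y\<close>, then \<open>T\<^sup>n x = n y + x\<close> for all \<open>n\<close>; since \<open>T\<^sup>m\<close> is the
  identity, \<open>m y = 0\<close>.
\<close>

lemma star_eq_zero_of_star_star_eq_zero: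
  assumes a: "a \<in> carrier B" and x: "x \<in> I" and m: "a [^] (m :: nat) = \<one>"
    and free: "\<And>y. y \<in> I \<Longrightarrow> y [^] m = \<one> \<Longrightarrow> y = \<one>"
    and ss: "star B a (star B a x) = \<zero>"
  shows "star B a x = \<zero>"
proof -
  let ?y = "star B a x"
  have y: "?y \<in> I" using a x by (rule star_mem)
  have xc: "x \<in> carrier B" and yc: "?y \<in> carrier B" using x y by (auto simp: I_closed)
  have fixy: "lam B a ?y = ?y" using ss star_eq_zero_iff a yc by blast
  have powI: "?y [^] n \<in> I" for n :: nat
    using y by (induction n) (auto simp: one_eq_zero[symmetric])
  have pow: "lam B (a [^] n) x = ?y [^] n \<oplus> x" for n :: nat
  proof (induction n)
    case 0
    show ?case using xc by (simp add: lam_one) (simp add: one_eq_zero)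
  next
    case (Suc n)
    have "lam B (a [^] n) ?y = ?y"
      using a yc fixy by (induction n) (auto simp: lam_one lam_mult)
    then have "lam B (a [^] Suc n) x = ?y \<oplus> (?y [^] n \<oplus> x)"
      using a xc yc Suc by (simp add: lam_mult lam_eq_star_add[of a x] lam_add)
    also have "\<dots> = ?y [^] Suc n \<oplus> x"
      using y powI[of n] xc by (simp add: trivial abelian I_closed add_assoc[symmetric])
    finally show ?case .
  qed
  have "?y [^] m \<oplus> x = x" using pow[of m] m xc by (simp add: lam_one)
  then have "?y [^] m = \<one>"
    using xc I_closed[OF powI] by (metis add_assoc add_simps(3,4,7) one_eq_zero)
  then show ?thesis using free[OF y] by (simp add: one_eq_zero)
qed

text \<open>
  A unipotent automorphism of finite order \<open>m\<close> of a group without \<open>m\<close>-torsion is the identity: the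
  previous lemma lowers the nilpotency exponent of \<open>T - 1\<close> one by one.
\<close>

lemma lam_fix_of_nilpotent:
  assumes a: "a \<in> carrier B" and x: "x \<in> I" and m: "a [^] (m :: nat) = \<one>"
    and free: "\<And>y. y \<in> I \<Longrightarrow> y [^] m = \<one> \<Longrightarrow> y = \<one>"
    and nil: "(star B a ^^ k) x = \<zero>"
  shows "lam B a x = x"
proof -
  have "star B a x = \<zero>" using x nil
  proof (induction k arbitrary: x)
    case 0
    then show ?case using a by (simp add: star_zero)
  next
    case (Suc k)
    have "star B a (star B a x) = \<zero>"
      using Suc.IH[OF star_mem[OF a Suc.prems(1)]] Suc.prems(2) unfolding funpow_Suc_right by simp
    from star_eq_zero_of_star_star_eq_zero[OF a Suc.prems(1) m free this] show ?case .
  qed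
  then show ?thesis using a x by (simp add: star_eq_zero_iff I_closed)
qed

end


section \<open>Averaging over a transversal\<close>

text \<open>
  The situation in which averaging applies: \<open>I\<close> has no torsion with respect to the order of \<open>H\<close>, and
  \<open>H\<close> acts trivially on it. The torsion condition makes \<open>H\<close> a transversal of \<open>I\<close> in \<open>I <#> H\<close>.
\<close>

locale coprime_layer = abelian_layer +
  fixes H
  assumes H_subgroup: "subgroup H B"
    and H_finite: "finite H"
    and torsion_free: "x \<in> I \<Longrightarrow> x [^] card H = \<one> \<Longrightarrow> x = \<one>"
    and product_subgroup: "subgroup (I <#> H) (add_monoid B)"
    and lam_fix: "h \<in> H \<Longrightarrow> x \<in> I \<Longrightarrow> lam B h x = x"
begin

abbreviation layer ("S") where "S \<equiv> B\<lparr>carrier := I\<rparr>"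
abbreviation K where "K \<equiv> I <#> H"

definition rep where "rep y = (THE k. k \<in> H \<and> I +> k = I +> y)"

text \<open>
  The component in \<open>I\<close> of \<open>y\<close> with respect to the transversal \<open>H\<close>, called \<open>\<delta>(y)\<close> in the
  introduction.
\<close>

definition dev where "dev y = y \<oplus> \<ominus> rep y"

text \<open>
  The map \<open>D\<close> of the introduction, a product over the layer. It compares the transversals \<open>c + H\<close>
  and \<open>H\<close> coset by coset.
\<close>

definition total_dev where "total_dev c = finprod (B\<lparr>carrier := I\<rparr>) (\<lambda>k. dev (c \<oplus> k)) H"

sublocale S: comm_group S by (rule layer_group)

lemma H_closed: "h \<in> H \<Longrightarrow> h \<in> carrier B"
  using subgroup.subset[OF H_subgroup] by blast

lemma K_closed: "y \<in> K \<Longrightarrow> y \<in> carrier B"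
  using subgroup.subset[OF product_subgroup] by auto

lemma K_add: "a \<in> K \<Longrightarrow> b \<in> K \<Longrightarrow> a \<oplus> b \<in> K"
  using subgroup.m_closed[OF product_subgroup, of a b] by simp

lemma K_neg: "a \<in> K \<Longrightarrow> \<ominus> a \<in> K"
  using subgroup.m_inv_closed[OF product_subgroup, of a] by (simp add: a_inv_def)

lemma layer_mult_mem_K: "x \<in> I \<Longrightarrow> h \<in> H \<Longrightarrow> x \<otimes> h \<in> K"
  by (auto simp: set_mult_def)

lemma H_subset_K: "h \<in> H \<Longrightarrow> h \<in> K"
  using layer_mult_mem_K[of \<one> h] H_closed[of h] by simp

lemma I_subset_K: "x \<in> I \<Longrightarrow> x \<in> K"
  using layer_mult_mem_K[of x \<one>] I_closed[of x] subgroup.one_closed[OF H_subgroup] by simp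

lemma coset_add: "a \<in> carrier B \<Longrightarrow> b \<in> carrier B \<Longrightarrow> I +> (a \<oplus> b) = (I +> a) <+> (I +> b)"
  using additive.rcos_sum[of a b] by (simp add: a_r_coset_def set_add_def)

lemma coset_add_left_cancel:
  assumes "a \<in> carrier B" "b \<in> carrier B" "c \<in> carrier B"
  shows "I +> (a \<oplus> b) = I +> (a \<oplus> c) \<longleftrightarrow> I +> b = I +> c"
proof
  assume "I +> (a \<oplus> b) = I +> (a \<oplus> c)"
  then have "I +> (\<ominus> a \<oplus> (a \<oplus> b)) = I +> (\<ominus> a \<oplus> (a \<oplus> c))"
    using assms coset_add[of "\<ominus> a" "a \<oplus> b"] coset_add[of "\<ominus> a" "a \<oplus> c"] by simp
  then show "I +> b = I +> c" using assms by simp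
qed (use assms coset_add in simp)

lemma coset_add_absorb: "x \<in> I \<Longrightarrow> y \<in> carrier B \<Longrightarrow> I +> (x \<oplus> y) = I +> y"
  using additive.coset_mult_assoc[of I x y] additive.coset_join2[OF _ additive.subgroup_axioms, of x]
    I_closed[of x] additive.subset by (simp add: a_r_coset_def)

lemma diff_mem_of_coset_eq:
  assumes "a \<in> carrier B" "b \<in> carrier B" "I +> a = I +> b"
  shows "a \<oplus> \<ominus> b \<in> I"
  using additive.rcos_module_imp[OF additive.is_group, of b a]
    additive.rcos_self[OF _ additive.subgroup_axioms, of a] assms
  by (simp add: a_r_coset_def a_inv_def)

text \<open>
  Additive and multiplicative cosets of an ideal agree, so two elements of \<open>H\<close> in one coset differ
  by an element of \<open>I \<inter> H\<close>. That group is trivial, for its elements are killed by the order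
  of \<open>H\<close>.
\<close>

lemma H_coset_inj:
  assumes h: "h \<in> H" and k: "k \<in> H" and eq: "I +> h = I +> k"
  shows "h = k"
proof -
  have "I #> h = I #> k" using h k eq by (simp add: add_coset_eq_mult_coset H_closed)
  then have "h \<otimes> inv k \<in> I"
    using h k multiplicative.rcos_module_imp[OF multiplicative.is_group, of k h]
      multiplicative.rcos_self[OF _ multiplicative.subgroup_axioms, of h] by (simp add: H_closed)
  moreover have "(h \<otimes> inv k) [^] card H = \<one>"
    using H_subgroup h k by (intro pow_subgroup_card) (auto simp: subgroup.m_closed subgroup.m_inv_closed)
  ultimately have "h \<otimes> inv k = \<one>" by (rule torsion_free)
  then show ?thesis using h k H_closed
    by (metis multiplicative.inv_equality multiplicative.inv_inv multiplicative.inv_closed)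
qed

lemma ex1_rep:
  assumes y: "y \<in> K"
  shows "\<exists>!k. k \<in> H \<and> I +> k = I +> y"
proof -
  obtain x h where xh: "x \<in> I" "h \<in> H" "y = x \<otimes> h"
    using y by (auto simp: set_mult_def)
  have "I #> y = I #> h"
    using xh multiplicative.coset_mult_assoc[of I x h] multiplicative.subset
      multiplicative.coset_join2[OF _ multiplicative.subgroup_axioms, of x] by (simp add: I_closed H_closed)
  then have "I +> h = I +> y" using y xh by (simp add: add_coset_eq_mult_coset H_closed K_closed)
  then show ?thesis using xh H_coset_inj by metis
qed

lemma rep:
  assumes "y \<in> K"
  shows "rep y \<in> H" "I +> rep y = I +> y"
  using theI'[OF ex1_rep[OF assms]] by (simp_all add: rep_def)

lemma rep_eqI: "h \<in> H \<Longrightarrow> y \<in> K \<Longrightarrow> I +> h = I +> y \<Longrightarrow> rep y = h"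
  using H_coset_inj rep by metis

lemma dev_mem: "y \<in> K \<Longrightarrow> dev y \<in> I"
  unfolding dev_def by (rule diff_mem_of_coset_eq) (auto simp: rep K_closed H_closed)

lemma dev_add_rep: "y \<in> K \<Longrightarrow> dev y \<oplus> rep y = y"
  by (simp add: dev_def rep H_closed K_closed add_assoc)

lemma rep_dev_of_H: "h \<in> H \<Longrightarrow> rep h = h \<and> dev h = \<one>"
  using rep_eqI[of h h] by (simp add: dev_def H_subset_K H_closed one_eq_zero)

lemma dev_add: 
  assumes "x \<in> I" "y \<in> K"
  shows "dev (x \<oplus> y) = x \<otimes> dev y"
proof -
  have "rep (x \<oplus> y) = rep y"
    using assms by (intro rep_eqI) (auto simp: rep coset_add_absorb K_closed K_add I_subset_K)
  then have "dev (x \<oplus> y) = x \<oplus> dev y"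
    using assms by (simp add: dev_def add_assoc I_closed K_closed H_closed rep)
  then show ?thesis using assms dev_mem by (simp add: trivial)
qed

text \<open>
  \<open>c + H\<close> is again a transversal, so passing to representatives in \<open>H\<close> permutes \<open>H\<close>. This
  permutation is what reindexes the products below.
\<close>

lemma rep_add_bij:
  assumes c: "c \<in> K"
  shows "bij_betw (\<lambda>k. rep (c \<oplus> k)) H H"
proof -
  have "inj_on (\<lambda>k. rep (c \<oplus> k)) H"
  proof (rule inj_onI)
    fix k l assume kl: "k \<in> H" "l \<in> H" "rep (c \<oplus> k) = rep (c \<oplus> l)"
    then have "I +> (c \<oplus> k) = I +> (c \<oplus> l)"
      using c rep(2) K_add H_subset_K by metis
    then show "k = l" using kl c by (simp add: coset_add_left_cancel K_closed H_closed H_coset_inj)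
  qed
  moreover have "(\<lambda>k. rep (c \<oplus> k)) ` H \<subseteq> H" using c rep(1) K_add H_subset_K by blast
  ultimately show ?thesis
    using H_finite by (simp add: bij_betw_def endo_inj_surj)
qed

lemma mult_bij:
  assumes h: "h \<in> H"
  shows "bij_betw (\<lambda>k. h \<otimes> k) H H"
proof -
  have "inj_on (\<lambda>k. h \<otimes> k) H" using h H_closed by (intro inj_onI) simp
  moreover have "(\<lambda>k. h \<otimes> k) ` H \<subseteq> H" using h H_subgroup by (auto simp: subgroup.m_closed)
  ultimately show ?thesis
    using H_finite by (simp add: bij_betw_def endo_inj_surj)
qed

lemma finprod_bij:
  assumes "bij_betw \<sigma> H H" "f \<in> H \<rightarrow> I"
  shows "finprod S (\<lambda>k. f (\<sigma> k)) H = finprod S f H"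
  using S.finprod_reindex[of f \<sigma> H] assms by (simp add: bij_betw_def)

lemma dev_shift_mem: "c \<in> K \<Longrightarrow> (\<lambda>k. dev (c \<oplus> k)) \<in> H \<rightarrow> I"
  by (auto intro: dev_mem K_add H_subset_K)

lemma total_dev_mem: "c \<in> K \<Longrightarrow> total_dev c \<in> I"
  using S.finprod_closed[of "\<lambda>k. dev (c \<oplus> k)" H] dev_shift_mem by (simp add: total_dev_def)

text \<open>
  The transversals \<open>b + c + H\<close> and \<open>H\<close> are compared via \<open>b + H\<close>. Translation by \<open>b\<close> on the left
  conjugates the deviation of \<open>c + H\<close> from \<open>H\<close> by \<open>b\<close>, and leaves the comparison of \<open>b + H\<close> with
  \<open>H\<close>.
\<close>

lemma total_dev_add:
  assumes b: "b \<in> K" and c: "c \<in> K"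
  shows "total_dev (b \<oplus> c) = (b \<oplus> total_dev c \<oplus> \<ominus> b) \<otimes> total_dev b"
proof -
  note mem = b c K_closed H_closed I_closed dev_mem K_add H_subset_K rep conj_mem
  have step: "dev (b \<oplus> c \<oplus> k) = (b \<oplus> dev (c \<oplus> k) \<oplus> \<ominus> b) \<otimes> dev (b \<oplus> rep (c \<oplus> k))"
    if k: "k \<in> H" for k
  proof -
    have "b \<oplus> c \<oplus> k = b \<oplus> (dev (c \<oplus> k) \<oplus> rep (c \<oplus> k))"
      using k by (simp add: mem dev_add_rep add_assoc)
    also have "\<dots> = (b \<oplus> dev (c \<oplus> k) \<oplus> \<ominus> b) \<oplus> (b \<oplus> rep (c \<oplus> k))"
      using k by (simp add: mem add_assoc)
    finally show ?thesis
      using dev_add[of "b \<oplus> dev (c \<oplus> k) \<oplus> \<ominus> b" "b \<oplus> rep (c \<oplus> k)"] k by (simp add: mem)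
  qed
  have "total_dev (b \<oplus> c)
      = finprod S (\<lambda>k. (b \<oplus> dev (c \<oplus> k) \<oplus> \<ominus> b) \<otimes>\<^bsub>S\<^esub> dev (b \<oplus> rep (c \<oplus> k))) H"
    unfolding total_dev_def by (rule S.finprod_cong') (auto simp: step mem)
  also have "\<dots> = finprod S (\<lambda>k. b \<oplus> dev (c \<oplus> k) \<oplus> \<ominus> b) H
      \<otimes>\<^bsub>S\<^esub> finprod S (\<lambda>k. dev (b \<oplus> rep (c \<oplus> k))) H"
    by (rule S.finprod_multf) (auto simp: mem)
  also have "finprod S (\<lambda>k. b \<oplus> dev (c \<oplus> k) \<oplus> \<ominus> b) H = b \<oplus> total_dev c \<oplus> \<ominus> b"
    using S.endo_finprod[OF conj_hom, of b "\<lambda>k. dev (c \<oplus> k)" H] dev_shift_mem[OF c]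
    by (simp add: mem total_dev_def)
  also have "finprod S (\<lambda>k. dev (b \<oplus> rep (c \<oplus> k))) H = total_dev b"
    using finprod_bij[OF rep_add_bij[OF c] dev_shift_mem[OF b]] by (simp add: total_dev_def)
  finally show ?thesis by simp
qed

text \<open>
  \<open>x + k\<close> deviates from \<open>H\<close> by exactly \<open>x\<close> for each \<open>k \<in> H\<close>.
\<close>

lemma total_dev_layer:
  assumes x: "x \<in> I"
  shows "total_dev x = x [^] card H"
proof -
  have "total_dev x = finprod S (\<lambda>k. x) H"
    unfolding total_dev_def
    by (rule S.finprod_cong') (use x in \<open>auto simp: dev_add H_subset_K rep_dev_of_H I_closed\<close>)
  also have "\<dots> = x [^] card H"
    using x S.finprod_const[of x H] by (simp add: multiplicative.nat_pow_consistent[symmetric])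
  finally show ?thesis .
qed

lemma lam_eq_shift: "h \<in> H \<Longrightarrow> k \<in> H \<Longrightarrow> lam B h k = \<ominus> h \<oplus> (h \<otimes> k)"
  by (simp add: lam_def)

lemma H_mult: "h \<in> H \<Longrightarrow> k \<in> H \<Longrightarrow> h \<otimes> k \<in> H"
  using H_subgroup by (simp add: subgroup.m_closed)

lemma lam_mem_K: "h \<in> H \<Longrightarrow> k \<in> H \<Longrightarrow> lam B h k \<in> K"
  by (simp add: lam_eq_shift K_add K_neg H_subset_K H_mult)

text \<open>
  Since \<open>\<lambda>\<^sub>h(k) = -h + h \<circ> k\<close> and \<open>h \<circ> H = H\<close>, the transversals \<open>-h + H\<close> and \<open>\<lambda>\<^sub>h(H)\<close> are the same.
  This ties the additive translations that define \<open>D\<close> to the action of \<open>(H, \<circ>)\<close>.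
\<close>

lemma total_dev_neg:
  assumes h: "h \<in> H"
  shows "total_dev (\<ominus> h) = finprod S (\<lambda>k. dev (lam B h k)) H"
proof -
  have "finprod S (\<lambda>k. dev (lam B h k)) H = finprod S (\<lambda>k. dev (\<ominus> h \<oplus> (h \<otimes> k))) H"
    by (simp add: lam_def)
  also have "\<dots> = total_dev (\<ominus> h)"
    using finprod_bij[OF mult_bij[OF h] dev_shift_mem, of "\<ominus> h"] h
    by (simp add: total_dev_def K_neg H_subset_K)
  finally show ?thesis ..
qed

text \<open>
  \<open>\<lambda>\<^sub>h \<circ> \<lambda>\<^sub>k\<close> moves \<open>H\<close> by the deviation of \<open>\<lambda>\<^sub>k(H)\<close>, which \<open>\<lambda>\<^sub>h\<close> leaves unchanged because it fixes \<open>I\<close>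
  pointwise, and then by the deviation of \<open>\<lambda>\<^sub>h(H)\<close>.
\<close>

lemma total_dev_neg_mult:
  assumes h: "h \<in> H" and k: "k \<in> H"
  shows "total_dev (\<ominus> (h \<otimes> k)) = total_dev (\<ominus> h) \<otimes> total_dev (\<ominus> k)"
proof -
  note mem = h k H_closed I_closed K_closed dev_mem rep lam_mem_K
  have step: "dev (lam B (h \<otimes> k) l) = dev (lam B h (rep (lam B k l))) \<otimes> dev (lam B k l)"
    if l: "l \<in> H" for l
  proof -
    let ?y = "lam B k l"
    have "lam B (h \<otimes> k) l = lam B h (dev ?y \<oplus> rep ?y)"
      using l by (simp add: mem lam_mult dev_add_rep)
    also have "\<dots> = dev ?y \<oplus> lam B h (rep ?y)"
      using l by (simp add: mem lam_add lam_fix)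
    finally have "dev (lam B (h \<otimes> k) l) = dev ?y \<otimes> dev (lam B h (rep ?y))"
      using dev_add l by (simp add: mem)
    then show ?thesis
      using S.m_comm[of "dev ?y" "dev (lam B h (rep ?y))"] l by (simp add: mem)
  qed
  have bij: "bij_betw (\<lambda>l. rep (lam B k l)) H H"
  proof -
    have "bij_betw ((\<lambda>l. rep (\<ominus> k \<oplus> l)) \<circ> (\<lambda>l. k \<otimes> l)) H H"
      using k by (intro bij_betw_trans[OF mult_bij] rep_add_bij K_neg H_subset_K)
    then show ?thesis by (simp add: comp_def lam_def)
  qed
  have "total_dev (\<ominus> (h \<otimes> k))
      = finprod S (\<lambda>l. dev (lam B h (rep (lam B k l))) \<otimes>\<^bsub>S\<^esub> dev (lam B k l)) H"
    unfolding total_dev_neg[OF H_mult[OF h k]] by (rule S.finprod_cong') (auto simp: step mem)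
  also have "\<dots> = finprod S (\<lambda>l. dev (lam B h (rep (lam B k l)))) H
      \<otimes>\<^bsub>S\<^esub> finprod S (\<lambda>l. dev (lam B k l)) H"
    by (rule S.finprod_multf) (auto simp: mem)
  also have "finprod S (\<lambda>l. dev (lam B h (rep (lam B k l)))) H = total_dev (\<ominus> h)"
    using finprod_bij[OF bij, of "\<lambda>l. dev (lam B h l)"] h by (simp add: total_dev_neg mem Pi_iff)
  finally show ?thesis using k by (simp add: total_dev_neg)
qed

text \<open>
  A homomorphism from \<open>H\<close> into a group without torsion for the order of \<open>H\<close> is trivial.
\<close>

lemma total_dev_neg_eq_one:
  assumes h: "h \<in> H"
  shows "total_dev (\<ominus> h) = \<one>"
proof -
  have oneH: "\<one> \<in> H" using H_subgroup by (rule subgroup.one_closed)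
  have cl: "total_dev (\<ominus> k) \<in> I" if "k \<in> H" for k
    using that total_dev_mem K_neg H_subset_K by blast
  have one: "total_dev (\<ominus> \<one>) = \<one>"
    using total_dev_neg_mult[OF oneH oneH] I_closed[OF cl[OF oneH]]
    by (simp add: multiplicative.l_cancel_one')
  have "h [^] n \<in> H \<and> total_dev (\<ominus> (h [^] n)) = total_dev (\<ominus> h) [^] n" for n :: nat
    using one oneH h by (induction n) (auto simp: H_mult total_dev_neg_mult)
  from this[of "card H"] have "total_dev (\<ominus> h) [^] card H = \<one>"
    using pow_subgroup_card[OF H_subgroup h] one by simp
  then show ?thesis using torsion_free cl h by blast
qed

text \<open>
  Write \<open>c = x + h\<close> with \<open>x \<in> I\<close> and \<open>h \<in> H\<close>. Then \<open>x = c - h\<close> is a zero of \<open>D\<close> by the cocycle rule,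
  and hence is trivial by torsion-freeness.
\<close>

lemma mem_of_total_dev_eq_one:
  assumes c: "c \<in> K" and D: "total_dev c = \<one>"
  shows "c \<in> H"
proof -
  let ?x = "dev c" and ?h = "rep c"
  have h: "?h \<in> H" and x: "?x \<in> I" using c rep dev_mem by auto
  have "total_dev ?x = (c \<oplus> \<one> \<oplus> \<ominus> c) \<otimes> \<one>"
    using total_dev_add[of c "\<ominus> ?h"] c h D
    by (simp add: dev_def K_neg H_subset_K total_dev_neg_eq_one)
  also have "\<dots> = \<one>" using c K_closed[OF c] by (simp add: one_eq_zero)
  finally have "?x = \<one>" using torsion_free x by (simp add: total_dev_layer)
  then have "c = ?h" using dev_add_rep[OF c] h by (simp add: one_eq_zero H_closed)
  then show ?thesis using h by simp
qed

theorem H_additive_subgroup: "subgroup H (add_monoid B)"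
proof -
  have neg: "\<ominus> h \<in> H" if "h \<in> H" for h
    using that mem_of_total_dev_eq_one K_neg H_subset_K total_dev_neg_eq_one by blast
  have add: "h \<oplus> k \<in> H" if hk: "h \<in> H" "k \<in> H" for h k
  proof (rule mem_of_total_dev_eq_one)
    have D: "total_dev l = \<one>" if "l \<in> H" for l
      using total_dev_neg_eq_one[OF neg[OF that]] H_closed[OF that] by simp
    have "total_dev (h \<oplus> k) = (h \<oplus> \<one> \<oplus> \<ominus> h) \<otimes> \<one>"
      using total_dev_add[of h k] hk D by (simp add: H_subset_K)
    then show "total_dev (h \<oplus> k) = \<one>"
      using H_closed[OF hk(1)] by (simp add: one_eq_zero)
  qed (use hk in \<open>simp add: K_add H_subset_K\<close>)
  have "\<zero> \<in> H" using subgroup.one_closed[OF H_subgroup] by (simp add: one_eq_zero)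
  then show ?thesis
    using neg add H_closed by unfold_locales (auto simp: a_inv_def)
qed

end


section \<open>Reduction to a torsion-free layer\<close>

context abelian_layer
begin

definition powers where "powers m = (\<lambda>a. a [^] (m :: nat)) ` I"

lemma powers_subset: "powers m \<subseteq> I"
  using multiplicative.subgroup_axioms multiplicative.subgroup_int_pow_closed int_pow_int
  unfolding powers_def by (metis image_subsetI)

text \<open>
  As the image of a power map, \<open>powers m\<close> is mapped into itself by each endomorphism of the layer.
  Conjugations in both groups and all \<open>\<lambda>\<^sub>b\<close> restrict to such endomorphisms, which makes it an
  ideal.
\<close>

lemma powers_invariant:
  assumes \<phi>: "\<phi> \<in> hom (B\<lparr>carrier := I\<rparr>) (B\<lparr>carrier := I\<rparr>)"
  shows "\<phi> ` powers m \<subseteq> powers m"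
proof -
  interpret S: comm_group "B\<lparr>carrier := I\<rparr>" by (rule layer_group)
  interpret \<phi>: group_hom "B\<lparr>carrier := I\<rparr>" "B\<lparr>carrier := I\<rparr>" \<phi>
    using \<phi> by unfold_locales
  have "\<phi> (a [^] m) = \<phi> a [^] m" if "a \<in> I" for a
    using \<phi>.hom_nat_pow[of a m] that by (simp add: multiplicative.nat_pow_consistent[symmetric])
  moreover have "\<phi> a \<in> I" if "a \<in> I" for a using \<phi>.hom_closed that by simp
  ultimately show ?thesis by (auto simp: powers_def)
qed

lemma powers_subgroup: "subgroup (powers m) B"
proof -
  interpret S: comm_group "B\<lparr>carrier := I\<rparr>" by (rule layer_group)
  have "(\<lambda>a. a [^] m) \<in> hom (B\<lparr>carrier := I\<rparr>) (B\<lparr>carrier := I\<rparr>)"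
    using S.pow_mult_distrib[OF S.m_comm] S.nat_pow_closed
    by (auto simp: hom_def multiplicative.nat_pow_consistent[symmetric])
  then interpret p: group_hom "B\<lparr>carrier := I\<rparr>" "B\<lparr>carrier := I\<rparr>" "\<lambda>a. a [^] m"
    by unfold_locales
  show ?thesis
    using multiplicative.incl_subgroup[OF multiplicative.subgroup_axioms p.img_is_subgroup]
    by (simp add: powers_def)
qed

lemma mult_conj_hom:
  assumes b: "b \<in> carrier B"
  shows "(\<lambda>x. b \<otimes> x \<otimes> inv b) \<in> hom (B\<lparr>carrier := I\<rparr>) (B\<lparr>carrier := I\<rparr>)"
proof (rule homI)
  fix x y assume "x \<in> carrier (B\<lparr>carrier := I\<rparr>)" "y \<in> carrier (B\<lparr>carrier := I\<rparr>)"
  then have xy: "x \<in> carrier B" "y \<in> carrier B" by (auto simp: I_closed)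
  have "inv b \<otimes> (b \<otimes> z) = z" if "z \<in> carrier B" for z
    using b that by (simp flip: multiplicative.m_assoc)
  then show "b \<otimes> (x \<otimes>\<^bsub>B\<lparr>carrier := I\<rparr>\<^esub> y) \<otimes> inv b
      = (b \<otimes> x \<otimes> inv b) \<otimes>\<^bsub>B\<lparr>carrier := I\<rparr>\<^esub> (b \<otimes> y \<otimes> inv b)"
    using b xy by (simp add: multiplicative.m_assoc)
qed (use b multiplicative.inv_op_closed2 in auto)

lemma neg_eq_inv: "x \<in> I \<Longrightarrow> \<ominus> x = inv x"
  using trivial[of "inv x" x] additive.inv_equality[of "inv x" x]
  by (simp add: a_inv_def I_closed one_eq_zero)

lemma powers_ideal: "skew_brace_ideal (powers m) B"
proof -
  have add: "subgroup (powers m) (add_monoid B)"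
  proof (rule additive.subgroupI)
    fix a b assume "a \<in> powers m" "b \<in> powers m"
    then show "a \<otimes>\<^bsub>add_monoid B\<^esub> b \<in> powers m"
      using subgroup.m_closed[OF powers_subgroup] powers_subset by (metis trivial monoid.simps(1) subsetD)
  next
    fix a assume "a \<in> powers m"
    then show "inv\<^bsub>add_monoid B\<^esub> a \<in> powers m"
      using subgroup.m_inv_closed[OF powers_subgroup] powers_subset neg_eq_inv
      by (metis a_inv_def subsetD)
  qed (use powers_subset[of m] I_closed subgroup.one_closed[OF powers_subgroup, of m] in \<open>auto simp: subset_iff\<close>)
  show ?thesis
    unfolding skew_brace_ideal_def additive.normal_inv_iff multiplicative.normal_inv_iff
    using add powers_subgroup powers_invariant[OF conj_hom] powers_invariant[OF mult_conj_hom]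
      powers_invariant[OF lam_hom]
    by (auto simp: a_inv_def image_subset_iff)
qed

lemma powers_layer: "abelian_layer B (powers m)"
proof -
  interpret skew_brace_with_ideal B "powers m" using powers_ideal by unfold_locales
  show ?thesis
    using powers_subset[of m] by unfold_locales (auto intro: trivial abelian)
qed

text \<open>
  The layer is cut down to the ideal of its \<open>m\<close>-th powers, where \<open>m\<close> is the order of \<open>H\<close>. If \<open>t\<close> is
  the index of \<open>H\<close>, then \<open>a\<^sup>t \<in> H\<close> for each \<open>a\<close> in the layer. With \<open>u m + v t = 1\<close> this writes
  \<open>a\<close> as an \<open>m\<close>-th power times an element of \<open>H\<close>, so that the product with \<open>H\<close> does not
  change; and an \<open>m\<close>-th power that is killed by \<open>m\<close> is killed by \<open>t\<close> too, so it is trivial.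
\<close>

lemma additive_subgroup_of_coprime_index:
  assumes fin: "finite (carrier B)" and H: "subgroup H B"
    and t: "order B = card H * t" and coprime: "coprime (card H) t"
    and prod: "subgroup (I <#> H) (add_monoid B)"
    and nil: "\<And>a x. a \<in> carrier B \<Longrightarrow> x \<in> carrier B \<Longrightarrow> (star B a ^^ k) x = \<zero>"
  shows "subgroup H (add_monoid B)"
proof -
  let ?m = "card H"
  let ?P = "powers ?m"
  have pow_t: "a [^] t \<in> H" if "a \<in> I" for a
    using multiplicative.pow_index_mem[OF fin H t layer_group that] .
  have Hc: "h \<in> carrier B" if "h \<in> H" for h using H that by (rule subgroup.mem_carrier)
  have free: "y = \<one>" if y: "y \<in> ?P" "y [^] ?m = \<one>" for y
  proof -
    obtain a where a: "a \<in> I" "y = a [^] ?m" using y by (auto simp: powers_def)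
    have "y [^] t = (a [^] t) [^] ?m"
      using a by (simp add: multiplicative.nat_pow_pow I_closed mult.commute)
    also have "\<dots> = \<one>" using H pow_t a by (simp add: pow_subgroup_card)
    finally have "y [^] t = \<one>" .
    moreover have yc: "y \<in> carrier B" using a by (simp add: I_closed)
    ultimately have "group.ord B y dvd ?m" "group.ord B y dvd t"
      using y multiplicative.pow_eq_id by auto
    then have "group.ord B y = 1" using coprime coprime_common_divisor_nat by blast
    then show ?thesis using multiplicative.ord_eq_1 yc by blast
  qed
  have split: "?P <#> H = I <#> H"
  proof
    show "?P <#> H \<subseteq> I <#> H" using powers_subset by (rule mono_set_mult) simp
    show "I <#> H \<subseteq> ?P <#> H"
    proof
      fix y assume "y \<in> I <#> H"
      then obtain a h where ah: "a \<in> I" "h \<in> H" "y = a \<otimes> h" by (auto simp: set_mult_def)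
      have ac: "a \<in> carrier B" using ah I_closed by blast
      obtain u v :: int where "u * int ?m + v * int t = 1"
        using bezout_int[of "int ?m" "int t"] coprime by auto
      then have "a = a [^] (u * int ?m + int t * v)" using ac by (simp add: mult.commute)
      also have "\<dots> = (a [^] u) [^] ?m \<otimes> (a [^] t) [^] v"
        using ac by (simp add: multiplicative.int_pow_mult multiplicative.int_pow_pow[symmetric] int_pow_int)
      finally have "a \<otimes> h = (a [^] u) [^] ?m \<otimes> (a [^] t) [^] v \<otimes> h"
        by (rule arg_cong)
      then have "y = (a [^] u) [^] ?m \<otimes> ((a [^] t) [^] v \<otimes> h)"
        using ah ac Hc by (simp add: multiplicative.m_assoc)
      moreover have "(a [^] u) [^] ?m \<in> ?P"
        using multiplicative.subgroup_int_pow_closed[OF multiplicative.subgroup_axioms ah(1)]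
        by (auto simp: powers_def)
      moreover have "(a [^] t) [^] v \<otimes> h \<in> H"
        using H ah pow_t multiplicative.subgroup_int_pow_closed[OF H] by (simp add: subgroup.m_closed)
      ultimately show "y \<in> ?P <#> H" by (auto simp: set_mult_def)
    qed
  qed
  interpret P: abelian_layer B ?P by (rule powers_layer)
  interpret coprime_layer B ?P H
  proof (intro coprime_layer.intro coprime_layer_axioms.intro powers_layer)
    fix h x assume hx: "h \<in> H" "x \<in> ?P"
    show "lam B h x = x"
      using P.lam_fix_of_nilpotent[OF Hc[OF hx(1)] hx(2) pow_subgroup_card[OF H hx(1)] free nil]
        hx Hc P.I_closed by blast
  qed (use H free prod finite_subset[OF subgroup.subset[OF H] fin] in \<open>simp_all add: split\<close>)
  show ?thesis by (rule H_additive_subgroup)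
qed

end


section \<open>Lifting from quotients\<close>

context skew_brace_with_ideal
begin

sublocale quotient: skew_brace "B Quot I" by (rule quotient_skew_brace)

lemma quotient_additive_hom: "group_hom (add_monoid B) (add_monoid (B Quot I)) (\<lambda>a. I +> a)"
  using additive.is_group quotient.additive.is_group
  by (auto simp: group_hom_def group_hom_axioms_def hom_def quotient_add quotient_carrier)

lemma quotient_multiplicative_hom: "group_hom B (B Quot I) (\<lambda>a. I +> a)"
  using multiplicative.is_group quotient.multiplicative.is_group
  by (auto simp: group_hom_def group_hom_axioms_def hom_def quotient_mult quotient_carrier)

lemma quotient_neg:
  assumes "a \<in> carrier B"
  shows "\<ominus>\<^bsub>B Quot I\<^esub> (I +> a) = I +> \<ominus> a"
proof -
  have "a \<in> carrier (add_monoid B)" using assms by simp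
  then show ?thesis unfolding a_inv_def by (rule group_hom.hom_inv[OF quotient_additive_hom, symmetric])
qed

lemma quotient_lam:
  "a \<in> carrier B \<Longrightarrow> b \<in> carrier B \<Longrightarrow> lam (B Quot I) (I +> a) (I +> b) = I +> lam B a b"
  by (simp add: lam_def quotient_neg quotient_add quotient_mult)

lemma quotient_star:
  "a \<in> carrier B \<Longrightarrow> b \<in> carrier B \<Longrightarrow> star (B Quot I) (I +> a) (I +> b) = I +> star B a b"
  by (simp add: star_def a_minus_def quotient_lam quotient_neg quotient_add)

lemma quotient_star_funpow:
  assumes "a \<in> carrier B" "b \<in> carrier B"
  shows "(star (B Quot I) (I +> a) ^^ k) (I +> b) = I +> (star B a ^^ k) b"
proof -
  have "(star B a ^^ k) b \<in> carrier B" for k using assms by (induction k) auto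
  then show ?thesis using assms by (induction k) (auto simp: quotient_star)
qed

lemma quotient_ideal:
  assumes A: "skew_brace_ideal A B"
  shows "skew_brace_ideal ((\<lambda>a. I +> a) ` A) (B Quot I)"
proof -
  interpret A: skew_brace_with_ideal B A using A by unfold_locales
  have "(\<lambda>a. I +> a) ` A \<lhd> add_monoid (B Quot I)"
    by (rule A.additive.surj_hom_normal_subgroup[OF quotient_additive_hom]) (simp add: quotient_carrier)
  moreover have "(\<lambda>a. I +> a) ` A \<lhd> B Quot I"
    by (rule A.multiplicative.surj_hom_normal_subgroup[OF quotient_multiplicative_hom])
      (simp add: quotient_carrier)
  ultimately show ?thesis
    using A.lam_ideal A.multiplicative.subset
    by (auto simp: skew_brace_ideal_def quotient_carrier quotient_lam subset_iff)
qed

text \<open>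
  \<open>I <#> H\<close> is the full preimage of the image of \<open>H\<close> in the quotient, so that additive closure can
  be lifted from there.
\<close>

lemma quotient_image_mem_iff:
  assumes H: "H \<subseteq> carrier B" and y: "y \<in> carrier B"
  shows "I +> y \<in> (\<lambda>a. I +> a) ` H \<longleftrightarrow> y \<in> I <#> H"
proof -
  have "I #> y = I #> h \<longleftrightarrow> y \<in> I #> h" if "h \<in> H" for h
    using that H y multiplicative.repr_independence[OF _ _ multiplicative.subgroup_axioms, of y h]
      multiplicative.rcos_self[OF _ multiplicative.subgroup_axioms, of y] by auto
  then show ?thesis
    using H y by (auto simp: add_coset_eq_mult_coset subset_iff set_mult_def r_coset_def image_iff)
qed

lemma subgroup_of_quotient_image:
  assumes H: "H \<subseteq> carrier B" and sub: "subgroup ((\<lambda>a. I +> a) ` H) (add_monoid (B Quot I))"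
  shows "subgroup (I <#> H) (add_monoid B)"
proof -
  have "{y \<in> carrier B. I +> y \<in> (\<lambda>a. I +> a) ` H} = I <#> H"
    using quotient_image_mem_iff[OF H] multiplicative.set_mult_closed[OF multiplicative.subset H] by blast
  moreover have "subgroup {y \<in> carrier B. I +> y \<in> (\<lambda>a. I +> a) ` H} (add_monoid B)"
  proof (rule additive.subgroupI)
    have "I +> \<zero> \<in> (\<lambda>a. I +> a) ` H"
      using subgroup.one_closed[OF sub] group_hom.hom_one[OF quotient_additive_hom] by simp
    then have "\<zero> \<in> {y \<in> carrier B. I +> y \<in> (\<lambda>a. I +> a) ` H}" by simp
    then show "{y \<in> carrier B. I +> y \<in> (\<lambda>a. I +> a) ` H} \<noteq> {}" by blast
  next
    fix a b
    assume "a \<in> {y \<in> carrier B. I +> y \<in> (\<lambda>a. I +> a) ` H}"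
      and "b \<in> {y \<in> carrier B. I +> y \<in> (\<lambda>a. I +> a) ` H}"
    then show "a \<otimes>\<^bsub>add_monoid B\<^esub> b \<in> {y \<in> carrier B. I +> y \<in> (\<lambda>a. I +> a) ` H}"
      using subgroup.m_closed[OF sub, of "I +> a" "I +> b"] by (simp add: quotient_add)
  next
    fix a assume "a \<in> {y \<in> carrier B. I +> y \<in> (\<lambda>a. I +> a) ` H}"
    then show "inv\<^bsub>add_monoid B\<^esub> a \<in> {y \<in> carrier B. I +> y \<in> (\<lambda>a. I +> a) ` H}"
      using subgroup.m_inv_closed[OF sub, of "I +> a"] unfolding a_inv_def[symmetric]
      by (simp add: quotient_neg)
  qed auto
  ultimately show ?thesis by simp
qed

text \<open>
  A factor of the series is formed inside the sub-skew brace \<open>A\<close>, whereas the argument needs \<open>A / I\<close>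
  inside \<open>B / I\<close>. The operations on cosets are the same in both.
\<close>

lemma quotient_layer:
  assumes A: "skew_brace_ideal A B"
    and triv: "trivial_skew_brace_of_abelian_type (B\<lparr>carrier := A\<rparr> Quot I)"
  shows "abelian_layer (B Quot I) ((\<lambda>a. I +> a) ` A)"
proof -
  let ?R = "B\<lparr>carrier := A\<rparr> Quot I"
  interpret T: trivial_skew_brace_of_abelian_type ?R by (rule triv)
  have car: "carrier ?R = (\<lambda>a. I +> a) ` A"
    by (auto simp: FactRing_def A_RCOSETS_def RCOSETS_def a_r_coset_def r_coset_def)
  have ops: "x \<otimes>\<^bsub>?R\<^esub> y = x \<otimes>\<^bsub>B Quot I\<^esub> y" "x \<oplus>\<^bsub>?R\<^esub> y = x \<oplus>\<^bsub>B Quot I\<^esub> y" for x y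
    by (simp_all add: FactRing_def rcoset_mult_def a_r_coset_def r_coset_def set_add_def set_mult_def)
  show ?thesis
  proof (intro abelian_layer.intro abelian_layer_axioms.intro skew_brace_with_ideal.intro
      skew_brace_with_ideal_axioms.intro quotient_skew_brace quotient_ideal A)
    fix x y assume xy: "x \<in> (\<lambda>a. I +> a) ` A" "y \<in> (\<lambda>a. I +> a) ` A"
    show "x \<otimes>\<^bsub>B Quot I\<^esub> y = x \<oplus>\<^bsub>B Quot I\<^esub> y"
      using T.operations_coincide[of x y] xy unfolding car ops by blast
    show "x \<oplus>\<^bsub>B Quot I\<^esub> y = y \<oplus>\<^bsub>B Quot I\<^esub> x"
      using comm_group.axioms(1)[OF T.additive_abelian] xy comm_monoid.m_comm[of "add_monoid ?R" x y]
      by (simp add: car ops)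
  qed
qed

text \<open>
  One step of the descent along the series, from \<open>A\<close> to the preceding ideal \<open>I\<close>.
\<close>

lemma additive_subgroup_step:
  assumes fin: "finite (carrier B)" and A: "skew_brace_ideal A B"
    and triv: "trivial_skew_brace_of_abelian_type (B\<lparr>carrier := A\<rparr> Quot I)"
    and H: "subgroup H B" and t: "order B = card H * t" and coprime: "coprime (card H) t"
    and prod: "subgroup (A <#> H) (add_monoid B)"
    and nil: "\<And>a x. a \<in> carrier B \<Longrightarrow> x \<in> carrier B \<Longrightarrow> (star B a ^^ k) x = \<zero>"
  shows "subgroup (I <#> H) (add_monoid B)"
proof (rule subgroup_of_quotient_image)
  let ?f = "\<lambda>a. I +> a"
  show Hc: "H \<subseteq> carrier B" using H by (rule subgroup.subset)
  have Ac: "A \<subseteq> carrier B"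
    using A normal_imp_subgroup subgroup.subset by (fastforce simp: skew_brace_ideal_def)
  interpret Q: abelian_layer "B Quot I" "?f ` A" using A triv by (rule quotient_layer)
  obtain u s where us: "t = u * s" "order (B Quot I) = card (?f ` H) * u"
    using group_hom.index_factorization[OF quotient_multiplicative_hom fin _ H t] quotient_carrier by metis
  have "card (?f ` H) dvd card H"
    using group_hom.card_image_times_card_kernel[OF quotient_multiplicative_hom fin H] by (metis dvd_triv_left)
  then have cop: "coprime (card (?f ` H)) u"
    using coprime us(1) by (metis coprime_divisors dvd_triv_left)
  have "subgroup (?f ` A <#>\<^bsub>B Quot I\<^esub> ?f ` H) (add_monoid (B Quot I))"
    using group_hom.subgroup_img_is_subgroup[OF quotient_additive_hom prod]
      group_hom.hom_set_mult[OF quotient_multiplicative_hom Ac Hc] by simp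
  then show "subgroup (?f ` H) (add_monoid (B Quot I))"
  proof (rule Q.additive_subgroup_of_coprime_index[rotated 4])
    show "(star (B Quot I) a ^^ k) x = \<zero>\<^bsub>B Quot I\<^esub>"
      if "a \<in> carrier (B Quot I)" "x \<in> carrier (B Quot I)" for a x
      using that nil group_hom.hom_one[OF quotient_additive_hom] by (auto simp: quotient_carrier quotient_star_funpow)
  qed (use fin us cop group_hom.subgroup_img_is_subgroup[OF quotient_multiplicative_hom H] quotient_carrier in auto)
qed

end

text \<open>
  The descent takes place inside \<open>B\<close>, with quotients used for single steps only; an induction on
  the quotients themselves would change the type of the elements at each step.
\<close>

lemma (in skew_brace) additive_subgroup_of_coprime_order_index:
  assumes fin: "finite (carrier B)" and sol: "soluble_skew_brace B" and nil: "left_nilpotent B"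
    and H: "subgroup H B" and t: "order B = card H * t" and coprime: "coprime (card H) t"
  shows "subgroup H (add_monoid B)"
proof -
  obtain n I where I0: "I 0 = {\<zero>}" and In: "I n = carrier B"
    and ideals: "\<And>j. j \<le> n \<Longrightarrow> skew_brace_ideal (I j) B"
    and triv: "\<And>j. j < n \<Longrightarrow>
      trivial_skew_brace_of_abelian_type (B\<lparr>carrier := I (Suc j)\<rparr> Quot I j)"
    using sol by (auto simp: soluble_skew_brace_def)
  obtain k where "left_series B k = {\<zero>}" using nil by (auto simp: left_nilpotent_def)
  then have star: "(star B a ^^ k) x = \<zero>" if "a \<in> carrier B" "x \<in> carrier B" for a x
    using star_funpow_mem_left_series[OF that, of k] by simp
  have Hc: "H \<subseteq> carrier B" using H by (rule subgroup.subset)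
  have "subgroup (I 0 <#> H) (add_monoid B)"
  proof (rule inc_induct[of 0 n])
    have "carrier B <#> H = carrier B"
    proof
      show "carrier B <#> H \<subseteq> carrier B" using Hc by (intro multiplicative.set_mult_closed) auto
      show "carrier B \<subseteq> carrier B <#> H"
        using subgroup.one_closed[OF H] by (force simp: set_mult_def)
    qed
    then show "subgroup (I n <#> H) (add_monoid B)"
      using additive.subgroup_self by (simp add: In)
  next
    fix j assume j: "j < n" and prod: "subgroup (I (Suc j) <#> H) (add_monoid B)"
    interpret skew_brace_with_ideal B "I j" using ideals[of j] j by unfold_locales simp
    show "subgroup (I j <#> H) (add_monoid B)"
      using fin ideals[of "Suc j"] triv[OF j] H t coprime prod star j
      by (intro additive_subgroup_step) auto
  qed simp
  moreover have "I 0 <#> H = H"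
    using Hc by (force simp: I0 set_mult_def one_eq_zero[symmetric] subset_iff)
  ultimately show ?thesis by simp
qed


section \<open>Hall subgroups\<close>

text \<open>
  A prime dividing both factors would lie in \<open>\<pi>\<close>, and the greatest \<open>\<pi>\<close>-number dividing \<open>n\<close> could be
  multiplied by it.
\<close>

lemma pi_part_coprime_cofactor:
  assumes n: "n > 0" and t: "n = pi_part \<pi> n * t"
  shows "coprime (pi_part \<pi> n) t"
proof (rule ccontr)
  assume "\<not> coprime (pi_part \<pi> n) t"
  then have "gcd (pi_part \<pi> n) t \<noteq> 1" by (simp add: coprime_iff_gcd_eq_1)
  then obtain p where "Factorial_Ring.prime p" "p dvd gcd (pi_part \<pi> n) t"
    using prime_factor_nat by blast
  then have p: "Factorial_Ring.prime p" "p dvd pi_part \<pi> n" "p dvd t" by simp_all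
  have \<pi>: "pi_number \<pi> (pi_part \<pi> n)" using n by (rule pi_part_greatest)
  then have "p \<in> \<pi>" using p by (simp add: pi_number_def)
  then have "pi_number \<pi> (p * pi_part \<pi> n)"
    using \<pi> p(1) by (auto simp: pi_number_def prime_gt_0_nat prime_dvd_mult_iff dest: primes_dvd_imp_eq)
  moreover have "p * pi_part \<pi> n dvd n"
    using p(3) t by (metis mult.commute mult_dvd_mono dvd_refl)
  ultimately have "p * pi_part \<pi> n \<le> pi_part \<pi> n" using n by (intro pi_part_greatest(3))
  moreover have "pi_part \<pi> n > 0" using \<pi> by (simp add: pi_number_def)
  ultimately show False using p(1) prime_gt_1_nat[of p] by simp
qed

theorem theorem11:
  fixes B :: "('a, 'm) ring_scheme" and \<pi> :: "nat set" and H :: "'a set"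
  assumes "\<forall>p\<in>\<pi>. Factorial_Ring.prime p"
    and "skew_brace B"
    and "finite (carrier B)"
    and "soluble_skew_brace B"
    and "left_nilpotent B"
  shows "hall_sub_skew_brace \<pi> H B \<longleftrightarrow> hall_subgroup \<pi> H B"
proof
  assume "hall_sub_skew_brace \<pi> H B"
  then show "hall_subgroup \<pi> H B"
    by (simp add: hall_sub_skew_brace_def hall_subgroup_def sub_skew_brace_def)
next
  interpret skew_brace B by fact
  assume hall: "hall_subgroup \<pi> H B"
  then have H: "subgroup H B" and card: "card H = pi_part \<pi> (order B)"
    by (simp_all add: hall_subgroup_def)
  obtain t where t: "order B = card H * t"
    using multiplicative.lagrange[OF H] by (metis mult.commute)
  have "order B > 0" using assms(3) by (simp add: multiplicative.order_gt_0_iff_finite)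
  then have coprime: "coprime (card H) t"
    using pi_part_coprime_cofactor[of "order B" \<pi> t] t unfolding card by blast
  have "subgroup H (add_monoid B)"
    using additive_subgroup_of_coprime_order_index[OF assms(3-5) H t coprime] .
  with H card show "hall_sub_skew_brace \<pi> H B"
    by (simp add: hall_sub_skew_brace_def sub_skew_brace_def)
qed

end
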